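(* Let $\alpha \in \mathbb{R}_{>0}$ and let $\mathbb{N}_0[\alpha] = \{f(\alpha) : f(X) \in \mathbb{N}_0[X]\}$ as an additive monoid. The following are equivalent: (a) $\mathbb{N}_0[\alpha]$ is a proper OHFM; (b) $\alpha$ is algebraic and $\mathcal{A}(\mathbb{N}_0[\alpha]) = \{\alpha^j : 0 \le j \le \deg m_\alpha(X)\}$, where $m_\alpha(X)$ is the minimal polynomial of $\alpha$ over $\mathbb{Q}$. In addition, for every integer $d \ge 3$ there are infinitely many pairwise non-isomorphic (as semirings) algebraic semiring valuations $S_\beta$ of $\mathbb{N}_0[X]$ whose additive monoids $\mathbb{N}_0[\beta]$ are proper OHFMs of rank $d$.
   Context: Monoids are commutative, cancellative, additively written; $\mathbb{N}_0[\alpha]$ is reduced. An atom is a nonzero element $a$ with $a=x+y \Rightarrow x=0$ or $y=0$; $\mathcal{A}(M)$ is the set of atoms; $M$ is atomic if generated by its atoms. Factorizations of an element are formal sums of atoms (elements of the free commutative monoid on $\mathcal{A}(M)$) adding up to it; length = number of atoms with multiplicity. A UFM is an atomic monoid in which every element has exactly one factorization. An OHFM (other-half-factorial monoid) is an atomic monoid in which any two factorizations of the same element having the same length are equal. A proper OHFM is an OHFM that is not a UFM. For $\beta\in\mathbb{R}_{>0}$, the semiring valuation $S_\beta$ of $\mathbb{N}_0[X]$ is the subsemiring $\{f(\beta): f\in\mathbb{N}_0[X]\}$ of $\mathbb{R}$; it is algebraic if $\beta$ is algebraic; its additive monoid is $\mathbb{N}_0[\beta]$. The rank of a monoid $M$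 is the rank of its difference (Grothendieck) group $\mathrm{gp}(M)$, i.e. $\dim_\mathbb{Q}(\mathbb{Q}\otimes_\mathbb{Z}\mathrm{gp}(M))$.
   Formalization: Condition (b) additionally requires α ≠ 1: for α = 1 the monoid is N_0, whose atom set {1} equals {1^0, 1^1}, so (b) as written holds, yet N_0 is a UFM and hence not a proper OHFM. *)

theory Defs
  imports Complex_Main "HOL-Library.Multiset" "HOL-Computational_Algebra.Computational_Algebra"
begin

section \<open>Commutative cancellative monoids and factorizations\<close>

text \<open>
  Additive commutative cancellative monoids are represented as carrier sets inside a type of class
  \<^class>\<open>cancel_comm_monoid_add\<close>, with the operation inherited from the type.
\<close>

definition add_submonoid :: "'a::cancel_comm_monoid_add set \<Rightarrow> bool" where
  "add_submonoid M \<longleftrightarrow> 0 \<in> M \<and> (\<forall>x\<in>M. \<forall>y\<in>M. x + y \<in> M)"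

text \<open>This is the usual notion of atom only for reduced monoids (0 is the only unit).\<close>

definition atoms :: "'a::cancel_comm_monoid_add set \<Rightarrow> 'a set" where
  "atoms M = {a \<in> M. a \<noteq> 0 \<and> (\<forall>x\<in>M. \<forall>y\<in>M. a = x + y \<longrightarrow> x = 0 \<or> y = 0)}"

definition atomic :: "'a::cancel_comm_monoid_add set \<Rightarrow> bool" where
  "atomic M \<longleftrightarrow> add_submonoid hull (atoms M) = M"

text \<open>
  Finite multisets of atoms are the elements of the free commutative monoid on the atoms; the
  length of a factorization is the size of the multiset.
\<close>

definition factorizations :: "'a::cancel_comm_monoid_add set \<Rightarrow> 'a \<Rightarrow> 'a multiset set" where
  "factorizations M x = {F. set_mset F \<subseteq> atoms M \<and> sum_mset F = x}"

definition UFM :: "'a::cancel_comm_monoid_add set \<Rightarrow> bool" where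
  "UFM M \<longleftrightarrow> add_submonoid M \<and> atomic M \<and> (\<forall>x\<in>M. \<exists>!F. F \<in> factorizations M x)"

definition OHFM :: "'a::cancel_comm_monoid_add set \<Rightarrow> bool" where
  "OHFM M \<longleftrightarrow> add_submonoid M \<and> atomic M \<and>
     (\<forall>x\<in>M. \<forall>F\<in>factorizations M x. \<forall>G\<in>factorizations M x. size F = size G \<longrightarrow> F = G)"

definition proper_OHFM :: "'a::cancel_comm_monoid_add set \<Rightarrow> bool" where
  "proper_OHFM M \<longleftrightarrow> OHFM M \<and> \<not> UFM M"


section \<open>Rank of an additive monoid of real numbers\<close>

definition gp :: "'a::ab_group_add set \<Rightarrow> 'a set" where
  "gp M = {x - y | x y. x \<in> M \<and> y \<in> M}"

interpretation rat_real: vector_space "\<lambda>(q::rat) (x::real). of_rat q * x"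
  by unfold_locales (simp_all add: algebra_simps of_rat_add of_rat_mult)

text \<open>
  The group \<open>G = gp M\<close> is a torsion-free subgroup of the rational vector space of the reals, so the
  canonical map from the tensor product of the rationals with \<open>G\<close> (sending the tensor of \<open>q\<close> and
  \<open>x\<close> to \<open>q * x\<close>) is injective, and its image is the rational span of \<open>G\<close>. The constant \<open>dim\<close>
  below, applied to a set, is the dimension of the span of that set.
\<close>

definition monoid_rank :: "real set \<Rightarrow> nat" where
  "monoid_rank M = vector_space.dim (\<lambda>(q::rat) (x::real). of_rat q * x) (gp M)"


section \<open>Semiring valuations and minimal polynomials\<close>

definition semiring_valuation :: "real \<Rightarrow> real set" where
  "semiring_valuation \<beta> = {poly (map_poly of_nat f) \<beta> | f :: nat poly. True}"

definition semiring_isomorphic :: "'a::semiring_1 set \<Rightarrow> 'b::semiring_1 set \<Rightarrow> bool" where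
  "semiring_isomorphic S T \<longleftrightarrow>
     (\<exists>h. bij_betw h S T \<and> h 0 = 0 \<and> h 1 = 1 \<and>
          (\<forall>x\<in>S. \<forall>y\<in>S. h (x + y) = h x + h y \<and> h (x * y) = h x * h y))"

definition is_min_poly :: "real \<Rightarrow> rat poly \<Rightarrow> bool" where
  "is_min_poly \<alpha> p \<longleftrightarrow> lead_coeff p = 1 \<and> poly (map_poly of_rat p) \<alpha> = 0 \<and>
     (\<forall>q. q \<noteq> 0 \<and> poly (map_poly of_rat q) \<alpha> = 0 \<longrightarrow> degree p \<le> degree q)"

text \<open>Meaningful for algebraic \<open>\<alpha>\<close> only, see \<open>ex1_min_poly\<close> below.\<close>

definition min_poly :: "real \<Rightarrow> rat poly" where
  "min_poly \<alpha> = (THE p. is_min_poly \<alpha> p)"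

lemma map_poly_of_rat_diff:
  "map_poly (of_rat :: rat \<Rightarrow> real) (p - q) = map_poly of_rat p - map_poly of_rat q"
  by (rule poly_eqI) (simp add: coeff_map_poly of_rat_diff)

lemma map_poly_of_rat_smult:
  "map_poly (of_rat :: rat \<Rightarrow> real) (smult c p) = smult (of_rat c) (map_poly of_rat p)"
  by (rule poly_eqI) (simp add: coeff_map_poly of_rat_mult)

lemma ex1_min_poly:
  assumes "algebraic \<alpha>"
  shows "\<exists>!p. is_min_poly \<alpha> p"
proof -
  define R where "R q \<longleftrightarrow> q \<noteq> 0 \<and> poly (map_poly of_rat q) \<alpha> = 0" for q :: "rat poly"
  obtain P where P: "\<And>i. coeff P i \<in> \<rat>" "P \<noteq> 0" "poly P \<alpha> = 0"
    using assms unfolding algebraic_altdef by blast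
  obtain q0 where q0: "P = map_poly of_rat q0"
    using ratpolyE[of P] P(1) by metis
  have "R q0" using P q0 by (auto simp: R_def)
  then obtain q where q: "R q" "\<And>r. R r \<Longrightarrow> degree q \<le> degree r"
    using ex_has_least_nat[of R q0 degree] by blast
  define p where "p = smult (inverse (lead_coeff q)) q"
  have "is_min_poly \<alpha> p"
    using q by (auto simp: is_min_poly_def p_def R_def map_poly_of_rat_smult)
  moreover have "p1 = p2" if "is_min_poly \<alpha> p1" "is_min_poly \<alpha> p2" for p1 p2
  proof (rule ccontr)
    assume ne: "p1 \<noteq> p2"
    have nz: "p1 \<noteq> 0" "p2 \<noteq> 0" using that by (auto simp: is_min_poly_def)
    then have deg: "degree p1 = degree p2"
      using that by (auto simp: is_min_poly_def intro!: antisym)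
    have root: "poly (map_poly of_rat (p1 - p2)) \<alpha> = 0"
      using that by (simp add: is_min_poly_def map_poly_of_rat_diff)
    then have le: "degree p1 \<le> degree (p1 - p2)"
      using that ne by (simp add: is_min_poly_def)
    have "degree (p1 - p2) \<le> degree p1" using deg degree_diff_le by (metis order_refl)
    then have "coeff (p1 - p2) (degree (p1 - p2)) = 0"
      using le that deg by (simp add: is_min_poly_def)
    then show False using ne by (metis leading_coeff_0_iff right_minus_eq)
  qed
  ultimately show ?thesis by blast
qed

end

theory Submission
  imports Defs
begin

text \<open>
  An additive relation among the powers of \<open>\<alpha>\<close> is a polynomial vanishing at \<open>\<alpha>\<close>, and its two sides
  have equal length iff the polynomial also vanishes at 1. So \<open>\<nat>\<^sub>0[\<alpha>]\<close>, whose atoms are the powers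
  below some exponent, is an OHFM iff no nonzero multiple of \<open>(X - 1) m\<^sub>\<alpha>(X)\<close> is supported on the
  exponents of the atoms, and a UFM iff no nonzero multiple of \<open>m\<^sub>\<alpha>(X)\<close> is. Hence a proper OHFM has
  exactly \<open>deg m\<^sub>\<alpha> + 1\<close> atoms.

  For rank \<open>d\<close> and a prime \<open>p\<close>, take a root \<open>\<beta> > 1\<close> of
  \<open>m(X) = X\<^sup>d + 2 p X - p (1 + X + \<dots> + X\<^bsup>d - 1\<^esup>)\<close>, which is irreducible by Eisenstein. Its positive
  linear coefficient keeps \<open>\<beta>\<^sup>d\<close> an atom, while \<open>(X + 1) m(X)\<close> writes \<open>\<beta>\<^bsup>d + 1\<^esup>\<close> as a sum of
  smaller powers. A semiring isomorphism permutes the powers that are atoms, so it maps generator to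
  generator; then one number satisfies the equations of both primes, which forces the primes to agree.
\<close>

section \<open>Formal sums of powers and their values\<close>

text \<open>A multiset of exponents stands for a polynomial in \<open>X\<close> with natural
  coefficients. This form keeps the length visible as \<open>size\<close>, and mapping
  \<open>(^) a\<close> over it gives a multiset of powers, hence a factorization once these powers
  are atoms.\<close>

definition power_sum :: "'a::comm_semiring_1 \<Rightarrow> nat multiset \<Rightarrow> 'a" where
  "power_sum a N = (\<Sum>j\<in>#N. a ^ j)"

text \<open>The target semiring is left open: the same multiset is read with natural, rational and
  real coefficients, so one formal sum serves membership in the valuation, minimality of
  \<open>min_poly\<close> and evaluation.\<close>

definition multiset_poly :: "nat multiset \<Rightarrow> 'a::comm_semiring_1 poly" where
  "multiset_poly N = (\<Sum>j\<in>#N. monom 1 j)"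

lemma power_sum_simps [simp]:
  "power_sum a {#} = 0"
  "power_sum a (add_mset j N) = a ^ j + power_sum a N"
  "power_sum a (M + N) = power_sum a M + power_sum a N"
  by (simp_all add: power_sum_def)

lemma power_sum_Sum: "power_sum x (\<Sum>i\<in>A. f i) = (\<Sum>i\<in>A. power_sum x (f i))"
  by (induction A rule: infinite_finite_induct) simp_all

lemma power_sum_shift: "power_sum a (image_mset ((+) k) N) = a ^ k * power_sum a N"
  by (induction N) (simp_all add: power_add algebra_simps)

lemma power_sum_Suc: "power_sum a (image_mset Suc N) = a * power_sum a N"
  by (induction N) (simp_all add: algebra_simps)

lemma power_sum_replicate [simp]: "power_sum a (replicate_mset n j) = of_nat n * a ^ j"
  by (induction n) (simp_all add: algebra_simps)

lemma power_sum_nonneg: "0 \<le> a \<Longrightarrow> 0 \<le> power_sum (a::real) N"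
  by (induction N) simp_all

lemma power_sum_eq_0_iff: "0 < a \<Longrightarrow> power_sum (a::real) N = 0 \<longleftrightarrow> N = {#}"
  by (cases N) (auto simp: add_pos_nonneg power_sum_nonneg less_imp_neq[symmetric])

lemma power_sum_ge_member: "0 \<le> a \<Longrightarrow> j \<in># N \<Longrightarrow> (a::real) ^ j \<le> power_sum a N"
  by (auto dest!: multi_member_split simp: power_sum_nonneg)

lemma power_sum_one: "power_sum 1 N = of_nat (size N)"
  by (induction N) simp_all

lemma coeff_multiset_poly [simp]: "coeff (multiset_poly N) i = of_nat (count N i)"
  by (induction N) (simp_all add: multiset_poly_def)

lemma poly_multiset_poly [simp]: "poly (multiset_poly N) a = power_sum a N"
  by (induction N) (simp_all add: multiset_poly_def poly_monom)

lemma semiring_valuation_eq: "semiring_valuation a = range (power_sum a)"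
proof -
  have map_add: "map_poly of_nat (f + g) = map_poly of_nat f + (map_poly of_nat g :: real poly)" for f g
    by (rule poly_eqI) (simp add: coeff_map_poly)
  have "\<exists>N. poly (map_poly of_nat f) a = power_sum a N" for f :: "nat poly"
  proof (induction f)
    case 0
    show ?case by (rule exI[of _ "{#}"]) simp
  next
    case (pCons c f)
    then obtain N where "poly (map_poly of_nat f) a = power_sum a N" by blast
    then show ?case
      \<comment> \<open>Horner step: the constant term \<open>c\<close> gives \<open>c\<close>
        copies of exponent 0, and multiplication by \<open>a\<close> raises all other exponents by
        one.\<close>
      by (intro exI[of _ "replicate_mset c 0 + image_mset Suc N"])
        (simp add: map_poly_pCons power_sum_Suc)
  qed
  moreover have "poly (map_poly of_nat (multiset_poly N)) a = power_sum a N" for N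
  proof -
    have "map_poly of_nat (multiset_poly N) = (multiset_poly N :: real poly)"
      by (rule poly_eqI) (simp add: coeff_map_poly)
    then show ?thesis by simp
  qed
  then have "power_sum a N \<in> semiring_valuation a" for N
    unfolding semiring_valuation_def by (smt (verit) mem_Collect_eq)
  ultimately show ?thesis
    by (fastforce simp: semiring_valuation_def)
qed

lemma semiring_valuationE:
  assumes "x \<in> semiring_valuation a"
  obtains N where "x = power_sum a N"
  using assms by (auto simp: semiring_valuation_eq)

lemma power_sum_in_valuation [simp]: "power_sum a N \<in> semiring_valuation a"
  by (simp add: semiring_valuation_eq)

lemma power_in_valuation [simp]: "a ^ j \<in> semiring_valuation a"
  using power_sum_in_valuation[of a "{#j#}"] by simp

lemma add_submonoid_valuation: "add_submonoid (semiring_valuation a)"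
  unfolding add_submonoid_def
  by (metis power_sum_in_valuation power_sum_simps(1,3) semiring_valuationE)

section \<open>Generated submonoids and existence of factorizations\<close>

lemma add_submonoid_hull:
  "add_submonoid hull A = {sum_mset F | F. set_mset F \<subseteq> A}"
proof (rule hull_unique)
  show "A \<subseteq> {sum_mset F | F. set_mset F \<subseteq> A}"
  proof
    fix x assume "x \<in> A"
    then show "x \<in> {sum_mset F | F. set_mset F \<subseteq> A}"
      by (intro CollectI exI[of _ "{#x#}"]) simp
  qed
  have "\<exists>H. sum_mset F + sum_mset G = sum_mset H \<and> set_mset H \<subseteq> A"
    if "set_mset F \<subseteq> A" "set_mset G \<subseteq> A" for F G
    using that by (intro exI[of _ "F + G"]) simp
  then show "add_submonoid {sum_mset F | F. set_mset F \<subseteq> A}"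
    by (auto simp: add_submonoid_def intro: exI[of _ "{#}"])
next
  fix T assume T: "A \<subseteq> T" "add_submonoid T"
  have "sum_mset F \<in> T" if "set_mset F \<subseteq> A" for F
    using that
  proof (induction F)
    case empty
    then show ?case using T by (simp add: add_submonoid_def)
  next
    case (add x F)
    then show ?case using T by (auto simp: add_submonoid_def)
  qed
  then show "{sum_mset F | F. set_mset F \<subseteq> A} \<subseteq> T" by blast
qed

lemma atomic_iff_factorizations:
  assumes "add_submonoid M"
  shows "atomic M \<longleftrightarrow> (\<forall>x\<in>M. factorizations M x \<noteq> {})"
proof -
  have "add_submonoid hull (atoms M) \<subseteq> M"
    using assms by (intro hull_minimal) (auto simp: atoms_def)
  then have "atomic M \<longleftrightarrow> M \<subseteq> add_submonoid hull (atoms M)"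
    by (auto simp: atomic_def)
  moreover have "x \<in> add_submonoid hull (atoms M) \<longleftrightarrow> factorizations M x \<noteq> {}" for x
    unfolding add_submonoid_hull factorizations_def mem_Collect_eq Collect_empty_eq by metis
  ultimately show ?thesis by (simp add: subset_eq)
qed

section \<open>Atoms of \<open>\<nat>\<^sub>0[\<alpha>]\<close>\<close>

text \<open>A nonzero element is some \<open>a ^ j\<close> plus a rest in the monoid; since
  \<open>a ^ j\<close> is positive, the rest of an atom must vanish.\<close>

lemma atom_is_power:
  assumes "0 < a" "x \<in> atoms (semiring_valuation a)"
  obtains j where "x = a ^ j"
proof -
  have x: "x \<in> semiring_valuation a" "x \<noteq> 0"
    using assms by (auto simp: atoms_def)
  then obtain N where N: "x = power_sum a N" by (blast elim: semiring_valuationE)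
  then obtain j N' where "N = add_mset j N'" using x by (cases N) auto
  then have eq: "x = a ^ j + power_sum a N'" using N by simp
  then have "a ^ j = 0 \<or> power_sum a N' = 0"
    using assms(2) power_in_valuation power_sum_in_valuation unfolding atoms_def by blast
  then show thesis using eq assms(1) that by simp
qed

text \<open>A decomposition of \<open>a ^ m\<close> times \<open>a ^ (n - m)\<close> is a
  decomposition of \<open>a ^ n\<close>. Hence the exponents of atoms form an initial segment of the
  naturals.\<close>

lemma atom_power_down:
  assumes "0 < a" "a ^ n \<in> atoms (semiring_valuation a)" "m \<le> n"
  shows "a ^ m \<in> atoms (semiring_valuation a)"
proof -
  have "x = 0 \<or> y = 0"
    if "x \<in> semiring_valuation a" "y \<in> semiring_valuation a" "a ^ m = x + y" for x y
  proof -
    have shift: "a ^ (n - m) * z \<in> semiring_valuation a" if "z \<in> semiring_valuation a" for z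
      using that by (metis power_sum_in_valuation power_sum_shift semiring_valuationE)
    have "a ^ n = a ^ (n - m) * x + a ^ (n - m) * y"
      using that(3) assms(3) by (metis distrib_left le_add_diff_inverse2 power_add)
    then have "a ^ (n - m) * x = 0 \<or> a ^ (n - m) * y = 0"
      using assms(2) shift that(1,2) unfolding atoms_def by blast
    then show ?thesis using assms(1) by simp
  qed
  then show ?thesis using assms(1) by (simp add: atoms_def)
qed

lemma valuation_ge_1:
  assumes "1 \<le> a" "x \<in> semiring_valuation a" "x \<noteq> 0"
  shows "1 \<le> x"
proof -
  obtain N where N: "x = power_sum a N" using assms(2) by (blast elim: semiring_valuationE)
  then obtain j where "j \<in># N" using assms(3) by (metis multiset_nonemptyE power_sum_simps(1))
  then show ?thesis
    using N power_sum_ge_member[of a j N] one_le_power[OF assms(1), of j] assms(1) by linarith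
qed

text \<open>All nonzero elements are at least 1, so splitting an element into two nonzero summands
  makes each smaller by at least 1. Induction on an integer upper bound therefore ends in
  atoms.\<close>

lemma valuation_atomic:
  assumes "1 \<le> a"
  shows "atomic (semiring_valuation a)"
proof -
  let ?M = "semiring_valuation a"
  have "x \<in> ?M \<Longrightarrow> x \<le> real n \<Longrightarrow> factorizations ?M x \<noteq> {}" for x n
  proof (induction n arbitrary: x)
    case 0
    then have "x = 0" using valuation_ge_1[OF assms] by fastforce
    then have "{#} \<in> factorizations ?M x" by (simp add: factorizations_def)
    then show ?case by blast
  next
    case (Suc n)
    consider "x = 0" | "x \<in> atoms ?M"
      | y z where "y \<in> ?M" "z \<in> ?M" "x = y + z" "y \<noteq> 0" "z \<noteq> 0"
      using Suc.prems(1) by (auto simp: atoms_def)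
    then show ?case
    proof cases
      case 1
      then have "{#} \<in> factorizations ?M x" by (simp add: factorizations_def)
      then show ?thesis by blast
    next
      case 2
      then have "{#x#} \<in> factorizations ?M x" by (simp add: factorizations_def)
      then show ?thesis by blast
    next
      case 3
      then have "y \<le> real n" "z \<le> real n"
        using Suc.prems valuation_ge_1[OF assms, of y] valuation_ge_1[OF assms, of z] by auto
      then obtain F G where "F \<in> factorizations ?M y" "G \<in> factorizations ?M z"
        using Suc.IH 3 by blast
      then have "F + G \<in> factorizations ?M x" using 3 by (auto simp: factorizations_def)
      then show ?thesis by blast
    qed
  qed
  then have "\<forall>x\<in>?M. factorizations ?M x \<noteq> {}" by (meson real_arch_simple)
  then show ?thesis by (simp add: atomic_iff_factorizations add_submonoid_valuation)
qed

text \<open>For \<open>a < 1\<close> an element of size at most \<open>a ^ n\<close> contains no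
  exponent below \<open>n\<close>, so it is \<open>a ^ n\<close> times an element. Both summands of
  \<open>a ^ n\<close> are of this kind, and cancelling \<open>a ^ n\<close> leaves a decomposition
  of 1. This later excludes \<open>a < 1\<close> when the atoms are finite in number.\<close>

lemma all_powers_atoms_if_less_1:
  assumes "0 < a" "a < 1" "1 \<in> atoms (semiring_valuation a)"
  shows "a ^ n \<in> atoms (semiring_valuation a)"
proof -
  have divisible: "\<exists>y. y \<in> semiring_valuation a \<and> x = a ^ n * y"
    if x: "x \<in> semiring_valuation a" "x \<le> a ^ n" for x
  proof -
    obtain N where N: "x = power_sum a N" using x(1) by (blast elim: semiring_valuationE)
    have ge: "n \<le> j" if "j \<in># N" for j
    proof (rule ccontr)
      assume "\<not> n \<le> j"
      then have "a ^ n < a ^ j" using assms by (simp add: power_strict_decreasing)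
      then show False using power_sum_ge_member[OF _ that, of a] N x(2) assms(1) by simp
    qed
    then have "image_mset ((+) n) (image_mset (\<lambda>j. j - n) N) = N"
      by (simp add: multiset.map_comp o_def cong: image_mset_cong)
    then have "x = a ^ n * power_sum a (image_mset (\<lambda>j. j - n) N)"
      using N power_sum_shift by metis
    then show ?thesis using power_sum_in_valuation by blast
  qed
  have "x = 0 \<or> y = 0"
    if xy: "x \<in> semiring_valuation a" "y \<in> semiring_valuation a" "a ^ n = x + y" for x y
  proof -
    have "0 \<le> x" "0 \<le> y"
      using xy assms(1) by (auto elim!: semiring_valuationE simp: power_sum_nonneg)
    then have "x \<le> a ^ n" "y \<le> a ^ n" unfolding xy(3) by simp_all
    then obtain x' y' where x': "x' \<in> semiring_valuation a" "x = a ^ n * x'"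
      and y': "y' \<in> semiring_valuation a" "y = a ^ n * y'"
      using divisible xy(1,2) by meson
    have "a ^ n * 1 = a ^ n * (x' + y')"
      using xy(3) x'(2) y'(2) by (simp add: distrib_left)
    then have "1 = x' + y'" using assms(1) by (metis assms(1) mult_cancel_left power_eq_0_iff less_irrefl)
    then have "x' = 0 \<or> y' = 0" using assms(3) x'(1) y'(1) unfolding atoms_def by blast
    then show ?thesis using x'(2) y'(2) by (metis mult_zero_right)
  qed
  then show ?thesis using assms(1) by (simp add: atoms_def)
qed

section \<open>Relations among powers and rational polynomials\<close>

lemma clear_denominators:
  fixes q :: "rat poly"
  obtains c :: int and r :: "int poly" where "c > 0" "smult (of_int c) q = map_poly of_int r"
proof -
  have "\<exists>c>0. \<exists>r. smult (of_int c) q = map_poly of_int r"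
  proof (induction q)
    case 0
    show ?case by (rule exI[of _ 1], simp, rule exI[of _ 0], simp)
  next
    case (pCons a q)
    then obtain c r where c: "c > 0" "smult (of_int c) q = map_poly of_int r" by blast
    obtain x y where xy: "a = of_int x / of_int y" "y > 0"
      by (metis quotient_of_denom_pos' quotient_of_div prod.collapse)
    have "smult (of_int (c * y)) (pCons a q) = pCons (of_int (c * x)) (smult (of_int y) (smult (of_int c) q))"
      using xy by (simp add: mult.commute)
    also have "\<dots> = map_poly of_int (pCons (c * x) (smult y r))"
      unfolding c(2) by (rule poly_eqI) (auto simp: coeff_map_poly coeff_pCons split: nat.splits)
    finally show ?case using c(1) xy(2) by (intro exI[of _ "c * y"]) auto
  qed
  then show thesis using that by blast
qed

text \<open>Together with \<open>root_imp_relation\<close> this is the dictionary between relations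
  among \<open>a ^ 0, ..., a ^ n\<close> and rational polynomials of degree at most \<open>n\<close>
  vanishing at \<open>a\<close>.\<close>

lemma relation_imp_root:
  assumes "P \<noteq> Q" "set_mset P \<subseteq> {..n}" "set_mset Q \<subseteq> {..n}" "power_sum a P = power_sum a Q"
  defines "q \<equiv> multiset_poly P - multiset_poly Q"
  shows "q \<noteq> 0" "degree q \<le> n" "poly (map_poly of_rat q) (a::real) = 0"
proof -
  show "q \<noteq> 0"
    using assms(1) by (auto simp: q_def multiset_eq_iff poly_eq_iff)
  have "count P i = 0" "count Q i = 0" if "i > n" for i
    using assms(2,3) that by (meson atMost_iff count_inI in_mono not_le)+
  then show "degree q \<le> n" by (intro degree_le) (simp add: q_def)
  have "map_poly of_rat q = (multiset_poly P - multiset_poly Q :: real poly)"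
    by (rule poly_eqI) (simp add: q_def coeff_map_poly of_rat_diff)
  then show "poly (map_poly of_rat q) a = 0" using assms(4) by simp
qed

lemma root_imp_relation:
  fixes q :: "rat poly" and a :: real
  assumes "q \<noteq> 0" "poly (map_poly of_rat q) a = 0" "degree q \<le> n"
  obtains P Q where "P \<noteq> Q" "set_mset P \<subseteq> {..n}" "set_mset Q \<subseteq> {..n}" "power_sum a P = power_sum a Q"
proof -
  obtain c r where c: "c > 0" and r: "smult (of_int c) q = map_poly of_int r"
    by (rule clear_denominators)
  have coeff_r: "of_int (coeff r i) = of_int c * coeff q i" for i
    using arg_cong[OF r, of "\<lambda>p. coeff p i"] by (simp add: coeff_map_poly)
  \<comment> \<open>The positive and the negative part of the integer polynomial \<open>r\<close>,
    so that \<open>r\<close> is their difference. \<open>Abs_multiset\<close> needs the finite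
    supports shown in \<open>fin\<close>.\<close>
  define P where "P = Abs_multiset (\<lambda>i. nat (coeff r i))"
  define Q where "Q = Abs_multiset (\<lambda>i. nat (- coeff r i))"
  have zero: "coeff r i = 0" if "i > n" for i
    using coeff_r[of i] that assms(3) by (simp add: coeff_eq_0)
  have fin: "finite {i. 0 < coeff r i}" "finite {i. 0 < - coeff r i}"
    by (rule finite_subset[of _ "{..n}"]; use zero in \<open>force simp: not_le[symmetric]\<close>)+
  have P: "count P i = nat (coeff r i)" and Q: "count Q i = nat (- coeff r i)" for i
    using fin by (simp_all add: P_def Q_def)
  have pq: "coeff r i = int (count P i) - int (count Q i)" for i
    by (simp add: P Q)
  have "P \<noteq> Q"
  proof
    assume "P = Q"
    then have "coeff r i = 0" for i by (simp add: pq)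
    then have "coeff q i = 0" for i using coeff_r[of i] c by simp
    then show False using assms(1) by (simp add: poly_eq_iff)
  qed
  moreover have "set_mset P \<subseteq> {..n}" "set_mset Q \<subseteq> {..n}"
    using zero by (auto simp: P Q simp flip: count_greater_zero_iff intro: leI ccontr)
  moreover have "(multiset_poly P - multiset_poly Q :: real poly) = smult (of_int c) (map_poly of_rat q)"
  proof (rule poly_eqI)
    fix i
    have "real_of_rat (of_int (coeff r i)) = of_rat (of_int c * coeff q i)"
      by (simp only: coeff_r)
    then show "coeff (multiset_poly P - multiset_poly Q :: real poly) i
        = coeff (smult (of_int c) (map_poly of_rat q)) i"
      by (simp add: coeff_map_poly of_rat_mult of_rat_diff pq)
  qed
  then have "power_sum a P - power_sum a Q = 0"
    using assms(2) by (metis mult_zero_right poly_diff poly_multiset_poly poly_smult)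
  ultimately show thesis using that by simp
qed

section \<open>Basic facts on minimal polynomials\<close>

lemma is_min_poly_min_poly: "algebraic a \<Longrightarrow> is_min_poly a (min_poly a)"
  unfolding min_poly_def using ex1_min_poly by (rule theI')

lemma min_poly_eqI: "is_min_poly a p \<Longrightarrow> algebraic a \<Longrightarrow> min_poly a = p"
  using ex1_min_poly is_min_poly_min_poly by blast

lemma algebraic_of_rat_root:
  assumes "q \<noteq> 0" "poly (map_poly of_rat q) (a::real) = 0"
  shows "algebraic a"
proof -
  have "map_poly of_rat q \<noteq> (0 :: real poly)"
    using assms(1) by (simp add: map_poly_eq_0_iff)
  then show ?thesis using assms(2) by (intro algebraicI') (auto simp: coeff_map_poly)
qed

section \<open>Characterization of proper OHFMs\<close>

text \<open>With this, \<open>image_power_factorization\<close> and \<open>factorizationE\<close>,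
  factorizations correspond one to one to multisets of exponents of atoms.\<close>

lemma inj_power:
  assumes "0 < (a::real)" "a \<noteq> 1"
  shows "inj ((^) a)"
proof (rule injI)
  fix m n assume "a ^ m = a ^ n"
  then have "real m * ln a = real n * ln a"
    using assms(1) by (metis ln_realpow)
  then show "m = n" using assms by simp
qed

lemma image_power_factorization:
  assumes "\<And>j. j \<in># P \<Longrightarrow> a ^ j \<in> atoms (semiring_valuation a)"
  shows "image_mset ((^) a) P \<in> factorizations (semiring_valuation a) (power_sum a P)"
  using assms by (auto simp: factorizations_def power_sum_def)

lemma factorizationE:
  assumes "0 < a" "F \<in> factorizations (semiring_valuation a) x"
  obtains P where "F = image_mset ((^) a) P" "x = power_sum a P"
    "\<And>j. j \<in># P \<Longrightarrow> a ^ j \<in> atoms (semiring_valuation a)"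
proof -
  have F: "\<And>y. y \<in># F \<Longrightarrow> y \<in> atoms (semiring_valuation a)" "sum_mset F = x"
    using assms(2) by (auto simp: factorizations_def)
  then have "\<forall>y\<in>set_mset F. \<exists>j. y = a ^ j"
    using atom_is_power[OF assms(1)] by metis
  then obtain e where e: "\<And>y. y \<in># F \<Longrightarrow> a ^ e y = y" by metis
  define P where "P = image_mset e F"
  have "image_mset (\<lambda>y. a ^ e y) F = image_mset (\<lambda>y. y) F"
    using e by (intro image_mset_cong)
  then have FP: "F = image_mset ((^) a) P"
    by (simp add: P_def multiset.map_comp o_def)
  moreover have "x = power_sum a P" using F(2) FP by (simp add: power_sum_def)
  moreover have "a ^ j \<in> atoms (semiring_valuation a)" if "j \<in># P" for j
    using that e F(1) by (auto simp: P_def)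
  ultimately show thesis using that by blast
qed

text \<open>Multiplying a relation by \<open>X - 1\<close> balances the lengths of its two sides.\<close>

lemma OHFM_no_relation:
  assumes "OHFM (semiring_valuation a)" "0 < a" "a \<noteq> 1"
    and atoms: "\<And>j. j \<le> Suc n \<Longrightarrow> a ^ j \<in> atoms (semiring_valuation a)"
    and PQ: "set_mset P \<subseteq> {..n}" "set_mset Q \<subseteq> {..n}" "power_sum a P = power_sum a Q"
  shows "P = Q"
proof -
  \<comment> \<open>As polynomials, \<open>P'\<close> minus \<open>Q'\<close> is
    \<open>X - 1\<close> times \<open>P\<close> minus \<open>Q\<close>. The shift by
    \<open>Suc\<close> is why the powers up to \<open>Suc n\<close> must be atoms.\<close>
  define P' where "P' = image_mset Suc P + Q"
  define Q' where "Q' = image_mset Suc Q + P"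
  have "power_sum a P' = power_sum a Q'"
    using PQ(3) by (simp add: P'_def Q'_def power_sum_Suc)
  moreover have "size P' = size Q'" by (simp add: P'_def Q'_def)
  moreover have "a ^ j \<in> atoms (semiring_valuation a)" if "j \<in># P' \<or> j \<in># Q'" for j
    using that PQ(1,2) by (intro atoms) (auto simp: P'_def Q'_def)
  ultimately have "image_mset ((^) a) P' = image_mset ((^) a) Q'"
    using assms(1) image_power_factorization[of P' a] image_power_factorization[of Q' a]
    unfolding OHFM_def by (metis power_sum_in_valuation size_image_mset)
  then have eq: "P' = Q'"
    using inj_power[OF assms(2,3)] by (metis injD multiset.inj_map)
  \<comment> \<open>Cancels the factor \<open>X - 1\<close>, comparing coefficients from the lowest
    exponent upwards.\<close>
  have "count P i = count Q i" for i
  proof (induction i)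
    case 0
    have "count P' 0 = count Q 0" "count Q' 0 = count P 0"
      by (auto simp: P'_def Q'_def count_eq_zero_iff)
    then show ?case by (simp add: eq)
  next
    case (Suc i)
    have "count (image_mset Suc N) (Suc i) = count N i" for N
      by (induction N) simp_all
    then have "count P' (Suc i) = count P i + count Q (Suc i)"
      "count Q' (Suc i) = count Q i + count P (Suc i)"
      by (simp_all add: P'_def Q'_def)
    then show ?case by (simp add: eq Suc)
  qed
  then show ?thesis by (simp add: multiset_eq_iff)
qed

text \<open>Failure of the UFM property yields a relation \<open>P\<close>, \<open>Q\<close> among
  atoms. By \<open>OHFM_no_relation\<close> not all powers are then atoms, so the atoms are
  \<open>a ^ 0, ..., a ^ n\<close> for some \<open>n\<close>. The relation bounds the degree of
  \<open>min_poly a\<close> above by \<open>n\<close>, and \<open>OHFM_no_relation\<close> bounds it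
  below.\<close>

lemma proper_OHFM_imp:
  assumes "0 < a" "proper_OHFM (semiring_valuation a)"
  shows "a \<noteq> 1 \<and> algebraic a \<and>
    atoms (semiring_valuation a) = {a ^ j | j. 0 \<le> j \<and> j \<le> degree (min_poly a)}"
proof -
  let ?S = "semiring_valuation a"
  have ohfm: "OHFM ?S" and not_ufm: "\<not> UFM ?S"
    using assms(2) by (auto simp: proper_OHFM_def)
  have "\<forall>x\<in>?S. factorizations ?S x \<noteq> {}"
    using ohfm atomic_iff_factorizations unfolding OHFM_def by blast
  then obtain x F G where FG: "F \<in> factorizations ?S x" "G \<in> factorizations ?S x" "F \<noteq> G"
    using ohfm not_ufm unfolding OHFM_def UFM_def by blast
  obtain P where P: "F = image_mset ((^) a) P" "x = power_sum a P" "\<And>j. j \<in># P \<Longrightarrow> a ^ j \<in> atoms ?S"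
    using factorizationE[OF assms(1) FG(1)] by blast
  obtain Q where Q: "G = image_mset ((^) a) Q" "x = power_sum a Q" "\<And>j. j \<in># Q \<Longrightarrow> a ^ j \<in> atoms ?S"
    using factorizationE[OF assms(1) FG(2)] by blast
  have "P \<noteq> Q" using FG(3) P(1) Q(1) by auto
  \<comment> \<open>For \<open>a = 1\<close> the value of a formal sum is its length, so
    factorizations of one element have equal length and an OHFM would be a UFM.\<close>
  have "a \<noteq> 1"
  proof
    assume "a = 1"
    then have "size P = size Q" using P(2) Q(2) by (simp add: power_sum_one)
    then have "size F = size G" using P(1) Q(1) by simp
    moreover have "x \<in> ?S" using P(2) by simp
    ultimately show False using ohfm FG unfolding OHFM_def by blast
  qed
  have no_relation: "P' = Q'"
    if "\<And>j. j \<le> Suc n \<Longrightarrow> a ^ j \<in> atoms ?S"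
      "set_mset P' \<subseteq> {..n}" "set_mset Q' \<subseteq> {..n}" "power_sum a P' = power_sum a Q'" for P' Q' n
    using OHFM_no_relation[OF ohfm assms(1) \<open>a \<noteq> 1\<close> that] .
  have "\<exists>m. a ^ m \<notin> atoms ?S"
  proof (rule ccontr)
    assume "\<nexists>m. a ^ m \<notin> atoms ?S"
    moreover obtain n where "\<forall>j\<in>set_mset (P + Q). j \<le> n"
      using finite_nat_set_iff_bounded_le finite_set_mset by metis
    ultimately have "P = Q" using P(2) Q(2) by (intro no_relation[of n]) auto
    then show False using \<open>P \<noteq> Q\<close> by simp
  qed
  define m where "m = (LEAST m. a ^ m \<notin> atoms ?S)"
  have m: "a ^ m \<notin> atoms ?S" using \<open>\<exists>m. a ^ m \<notin> atoms ?S\<close> unfolding m_def by (rule LeastI_ex)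
  have atom_iff: "a ^ j \<in> atoms ?S \<longleftrightarrow> j < m" for j
    using m atom_power_down[OF assms(1)] not_less_Least[of j "\<lambda>m. a ^ m \<notin> atoms ?S"]
    unfolding m_def by (metis not_le)
  have "m \<noteq> 0"
  proof
    assume "m = 0"
    then have "P = {#}" "Q = {#}" using P(3) Q(3) atom_iff by (auto intro: ccontr)
    then show False using \<open>P \<noteq> Q\<close> by simp
  qed
  then obtain n where n: "m = Suc n" using not0_implies_Suc by blast
  have "set_mset P \<subseteq> {..n}" "set_mset Q \<subseteq> {..n}"
    using P(3) Q(3) atom_iff n by (auto simp: less_Suc_eq_le)
  then obtain q where q: "q \<noteq> 0" "degree q \<le> n" "poly (map_poly of_rat q) a = 0"
    using relation_imp_root[OF \<open>P \<noteq> Q\<close>, of n a] P(2) Q(2) by metis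
  then have alg: "algebraic a" using algebraic_of_rat_root by blast
  note mp = is_min_poly_min_poly[OF alg]
  have "degree (min_poly a) \<le> n"
    using mp q unfolding is_min_poly_def by (meson order_trans)
  \<comment> \<open>Otherwise \<open>min_poly a\<close> is a relation with exponents at most
    \<open>n - 1\<close>; its shifted version stays within the atoms, the last of which is
    \<open>a ^ n\<close>.\<close>
  moreover have "\<not> degree (min_poly a) < n"
  proof
    assume lt: "degree (min_poly a) < n"
    have "min_poly a \<noteq> 0" "poly (map_poly of_rat (min_poly a)) a = 0"
      using mp by (auto simp: is_min_poly_def)
    moreover have "degree (min_poly a) \<le> n - 1" using lt by simp
    ultimately obtain P' Q' where PQ': "P' \<noteq> Q'" "set_mset P' \<subseteq> {..n - 1}"
      "set_mset Q' \<subseteq> {..n - 1}" "power_sum a P' = power_sum a Q'"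
      by (rule root_imp_relation)
    moreover have "P' = Q'"
      by (rule no_relation[OF _ PQ'(2-4)]) (use lt atom_iff n in simp)
    ultimately show False by simp
  qed
  ultimately have "degree (min_poly a) = n" by simp
  moreover have "atoms ?S = {a ^ j | j. j < m}"
    using atom_iff atom_is_power[OF assms(1)] by blast
  ultimately show ?thesis using alg \<open>a \<noteq> 1\<close> n by (simp add: less_Suc_eq_le)
qed

text \<open>If \<open>X - 1\<close> divided \<open>min_poly a\<close>, the cofactor would vanish at
  \<open>a \<noteq> 1\<close> and have smaller degree. The point is that no nonzero multiple of
  \<open>min_poly a\<close> by a scalar is a relation with sides of equal length.\<close>

lemma min_poly_at_1:
  assumes "algebraic a" "a \<noteq> 1"
  shows "poly (min_poly a) 1 \<noteq> 0"
proof
  note mp = is_min_poly_min_poly[OF assms(1)]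
  assume "poly (min_poly a) 1 = 0"
  then obtain q where q: "min_poly a = [:-1, 1:] * q" by (metis poly_eq_0_iff_dvd dvdE)
  have nz: "q \<noteq> 0" using mp q by (auto simp: is_min_poly_def)
  have map: "map_poly of_rat ([:-1, 1:] * q) = [:-1, 1:] * (map_poly of_rat q :: real poly)"
    by (rule poly_eqI) (simp add: coeff_map_poly coeff_pCons of_rat_diff of_rat_minus split: nat.splits)
  have "poly (map_poly of_rat ([:-1, 1:] * q)) a = 0"
    using mp unfolding is_min_poly_def q by blast
  then have "(a - 1) * poly (map_poly of_rat q) a = 0"
    unfolding map by (simp add: algebra_simps)
  then have "degree (min_poly a) \<le> degree q"
    using mp nz assms(2) by (simp add: is_min_poly_def)
  moreover have "degree (min_poly a) = Suc (degree q)"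
    unfolding q using nz by (subst degree_mult_eq) simp_all
  ultimately show False by simp
qed

text \<open>A relation among the atoms has degree at most that of \<open>min_poly a\<close>, so it
  is a scalar multiple of it. Equal lengths make it vanish at 1, which forces the scalar to be 0.
  \<open>min_poly a\<close> itself is a relation among the atoms and refutes the UFM
  property.\<close>

lemma proper_OHFM_if:
  assumes "0 < a" "a \<noteq> 1" "algebraic a"
    and atoms: "atoms (semiring_valuation a) = {a ^ j | j. 0 \<le> j \<and> j \<le> degree (min_poly a)}"
  shows "proper_OHFM (semiring_valuation a)"
proof -
  let ?S = "semiring_valuation a" and ?d = "degree (min_poly a)"
  note mp = is_min_poly_min_poly[OF assms(3)]
  note inj = inj_power[OF assms(1,2)]
  have atom_iff: "a ^ j \<in> atoms ?S \<longleftrightarrow> j \<le> ?d" for j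
    using inj by (auto simp: atoms dest: injD)
  \<comment> \<open>For \<open>a < 1\<close>, the atom 1 would make \<open>a ^ Suc ?d\<close> an
    atom too.\<close>
  have "\<not> a < 1"
    using all_powers_atoms_if_less_1[OF assms(1), of "Suc ?d"] atom_iff[of 0] atom_iff[of "Suc ?d"]
    by auto
  then have atomic: "atomic ?S" by (intro valuation_atomic) simp
  have "F = G" if F: "F \<in> factorizations ?S x" and G: "G \<in> factorizations ?S x"
    and size: "size F = size G" for x F G
  proof (rule ccontr)
    assume "F \<noteq> G"
    obtain P where P: "F = image_mset ((^) a) P" "x = power_sum a P" "\<And>j. j \<in># P \<Longrightarrow> a ^ j \<in> atoms ?S"
      using factorizationE[OF assms(1) F] by blast
    obtain Q where Q: "G = image_mset ((^) a) Q" "x = power_sum a Q" "\<And>j. j \<in># Q \<Longrightarrow> a ^ j \<in> atoms ?S"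
      using factorizationE[OF assms(1) G] by blast
    define q :: "rat poly" where "q = multiset_poly P - multiset_poly Q"
    have "P \<noteq> Q" using \<open>F \<noteq> G\<close> P(1) Q(1) by auto
    moreover have "set_mset P \<subseteq> {..?d}" "set_mset Q \<subseteq> {..?d}" using P(3) Q(3) atom_iff by auto
    ultimately have q: "q \<noteq> 0" "degree q \<le> ?d" "poly (map_poly of_rat q) a = 0"
      using relation_imp_root P(2) Q(2) unfolding q_def by metis+
    have "size P = size Q" using size P(1) Q(1) by simp
    then have "poly q 1 = 0" by (simp add: q_def power_sum_one)
    \<comment> \<open>Cancels the coefficient at \<open>?d\<close>; minimality of the degree then
      makes the remainder zero.\<close>
    define r where "r = q - smult (coeff q ?d) (min_poly a)"
    have "poly (map_poly of_rat r) a = 0"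
      using q(3) mp by (simp add: r_def map_poly_of_rat_diff map_poly_of_rat_smult is_min_poly_def)
    moreover have "degree r < ?d \<or> r = 0"
    proof -
      have "degree r \<le> ?d" unfolding r_def using q(2) by (intro degree_diff_le) auto
      moreover have "coeff r ?d = 0" using mp by (simp add: r_def is_min_poly_def)
      ultimately show ?thesis by (metis le_neq_implies_less leading_coeff_0_iff)
    qed
    ultimately have "r = 0" using mp unfolding is_min_poly_def by (meson not_le)
    then have eq: "q = smult (coeff q ?d) (min_poly a)" by (simp add: r_def)
    then have "coeff q ?d * poly (min_poly a) 1 = 0"
      using \<open>poly q 1 = 0\<close> by (metis poly_smult)
    then have "coeff q ?d = 0" using min_poly_at_1[OF assms(3,2)] by simp
    then show False using eq q(1) by simp
  qed
  then have "OHFM ?S" using atomic by (auto simp: OHFM_def add_submonoid_valuation)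
  moreover have "\<not> UFM ?S"
  proof
    assume ufm: "UFM ?S"
    have "min_poly a \<noteq> 0" using mp by (auto simp: is_min_poly_def)
    then obtain P Q where PQ: "P \<noteq> Q" "set_mset P \<subseteq> {..?d}" "set_mset Q \<subseteq> {..?d}"
      "power_sum a P = power_sum a Q"
      using root_imp_relation[of "min_poly a" a ?d] mp unfolding is_min_poly_def by auto
    have "image_mset ((^) a) P = image_mset ((^) a) Q"
      using ufm image_power_factorization[of P a] image_power_factorization[of Q a] PQ(2-4) atom_iff
      unfolding UFM_def by (metis atMost_iff power_sum_in_valuation subsetD)
    then show False using PQ(1) inj by (metis injD multiset.inj_map)
  qed
  ultimately show ?thesis by (simp add: proper_OHFM_def)
qed

section \<open>Eisenstein's criterion\<close>

text \<open>If \<open>p\<close> does not divide \<open>coeff s 0\<close>, take the first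
  \<open>i\<close> with \<open>p\<close> not dividing \<open>coeff r i\<close>. Modulo
  \<open>p\<close>, coefficient \<open>i\<close> of the product is
  \<open>coeff r i * coeff s 0\<close>, which is nonzero, although
  \<open>i \<le> degree r < degree (r * s)\<close>.\<close>

lemma eisenstein_factor_coeff_0:
  fixes r s :: "int poly"
  assumes "prime p" "\<not> p dvd lead_coeff (r * s)"
    and dvd: "\<And>i. i < degree (r * s) \<Longrightarrow> p dvd coeff (r * s) i"
    and "degree s > 0"
  shows "p dvd coeff s 0"
proof (rule ccontr)
  assume s0: "\<not> p dvd coeff s 0"
  have "\<not> p dvd lead_coeff r" using assms(2) by (auto simp: lead_coeff_mult)
  define i where "i = (LEAST i. \<not> p dvd coeff r i)"
  have i: "\<not> p dvd coeff r i" "i \<le> degree r"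
    unfolding i_def
    by (rule LeastI[of _ "degree r"], fact, rule Least_le, fact)
  have less: "p dvd coeff r j" if "j < i" for j
    using that not_less_Least unfolding i_def by blast
  have "r \<noteq> 0" "s \<noteq> 0" using assms(2) by auto
  then have "i < degree (r * s)" using i(2) assms(4) by (simp add: degree_mult_eq)
  then have "p dvd (\<Sum>j\<le>i. coeff r j * coeff s (i - j))" using dvd by (simp add: coeff_mult)
  also have "(\<Sum>j\<le>i. coeff r j * coeff s (i - j))
      = (\<Sum>j<i. coeff r j * coeff s (i - j)) + coeff r i * coeff s 0"
    by (simp flip: lessThan_Suc_atMost)
  finally have "p dvd coeff r i * coeff s 0"
    using less by (subst (asm) dvd_add_right_iff) (auto intro!: dvd_sum)
  then show False using assms(1) i(1) s0 by (simp add: prime_dvd_mult_iff)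
qed

lemma eisenstein:
  fixes r s :: "int poly"
  assumes "prime p" "\<not> p dvd lead_coeff (r * s)"
    and "\<And>i. i < degree (r * s) \<Longrightarrow> p dvd coeff (r * s) i"
    and "\<not> p\<^sup>2 dvd coeff (r * s) 0"
  shows "degree r = 0 \<or> degree s = 0"
proof (rule ccontr)
  assume "\<not> ?thesis"
  then have "p dvd coeff s 0" "p dvd coeff r 0"
    using eisenstein_factor_coeff_0[of p r s] eisenstein_factor_coeff_0[of p s r] assms
    by (auto simp: mult.commute[of s r])
  then have "p\<^sup>2 dvd coeff (r * s) 0"
    by (auto simp: power2_eq_square mult_0 coeff_mult_0 intro: mult_dvd_mono)
  then show False using assms(4) by simp
qed

text \<open>A primitive integer polynomial \<open>r\<close> of least degree vanishing at
  \<open>a\<close> divides a multiple \<open>k m\<close> by pseudo-division. Comparing contents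
  removes \<open>k\<close>, so \<open>r\<close> divides \<open>m\<close> over the integers, and
  Eisenstein leaves only a constant cofactor.\<close>

lemma eisenstein_min_degree:
  fixes m :: "int poly" and a :: real
  assumes "prime p" "lead_coeff m = 1"
    and dvd: "\<And>i. i < degree m \<Longrightarrow> p dvd coeff m i"
    and "\<not> p\<^sup>2 dvd coeff m 0"
    and root: "poly (map_poly of_int m) a = 0"
    and q: "q \<noteq> 0" "poly (map_poly of_rat q) a = 0"
  shows "degree m \<le> degree q"
proof -
  let ?e = "\<lambda>r :: int poly. poly (map_poly of_int r) a"
  have e_mult: "?e (r * s) = ?e r * ?e s" and e_add: "?e (r + s) = ?e r + ?e s"
    and e_smult: "?e (smult c r) = of_int c * ?e r" for r s c
  proof -
    have "map_poly of_int (r * s) = map_poly of_int r * (map_poly of_int s :: real poly)"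
      "map_poly of_int (r + s) = map_poly of_int r + (map_poly of_int s :: real poly)"
      "map_poly of_int (smult c r) = smult (of_int c) (map_poly of_int r :: real poly)"
      by (rule poly_eqI; simp add: coeff_map_poly coeff_mult)+
    then show "?e (r * s) = ?e r * ?e s" "?e (r + s) = ?e r + ?e s"
      "?e (smult c r) = of_int c * ?e r" by simp_all
  qed
  define R where "R r \<longleftrightarrow> r \<noteq> 0 \<and> ?e r = 0" for r
  obtain c r0 where c: "c > 0" "smult (of_int c) q = map_poly of_int r0"
    by (rule clear_denominators)
  have coeff_r0: "of_int (coeff r0 i) = of_int c * coeff q i" for i
    using arg_cong[OF c(2), of "\<lambda>p. coeff p i"] by (simp add: coeff_map_poly)
  have "r0 \<noteq> 0" using c q(1) by auto
  moreover have "map_poly of_int r0 = smult (of_int c) (map_poly of_rat q :: real poly)"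
  proof (rule poly_eqI)
    fix i
    have "real_of_rat (of_int (coeff r0 i)) = of_rat (of_int c * coeff q i)"
      by (simp only: coeff_r0)
    then show "coeff (map_poly of_int r0) i = coeff (smult (of_int c) (map_poly of_rat q :: real poly)) i"
      by (simp add: coeff_map_poly of_rat_mult)
  qed
  then have "?e r0 = 0" using q(2) by simp
  ultimately have r0: "R r0" by (simp add: R_def)
  have deg_r0: "degree r0 \<le> degree q"
    using coeff_r0 by (intro degree_le) (metis coeff_eq_0 mult_zero_right of_int_eq_0_iff)
  obtain r1 where r1: "R r1" "\<And>s. R s \<Longrightarrow> degree r1 \<le> degree s"
    using ex_has_least_nat[of R r0 degree] r0 by blast
  define r where "r = primitive_part r1"
  have r1_eq: "r1 = smult (content r1) r" by (simp add: r_def)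
  have "content r1 \<noteq> 0" "r \<noteq> 0" using r1(1) by (auto simp: R_def r_def)
  then have "R r" using r1(1) e_smult[of "content r1" r] r1_eq by (simp add: R_def)
  have cont_r: "content r = 1" using r1(1) by (simp add: R_def r_def)
  have "degree r \<le> degree r1" by (simp add: r_def)
  then have least: "degree r \<le> degree s" if "R s" for s using r1(2)[OF that] by simp
  obtain q1 s where ps: "pseudo_divmod m r = (q1, s)" by fastforce
  define k where "k = coeff r (degree r) ^ (Suc (degree m) - degree r)"
  have div: "smult k m = r * q1 + s" "s = 0 \<or> degree s < degree r"
    using pseudo_divmod[OF \<open>r \<noteq> 0\<close> ps] by (auto simp: k_def)
  have "?e s = 0"
    using arg_cong[OF div(1), of ?e] root \<open>R r\<close> by (simp add: e_mult e_add e_smult R_def)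
  then have "s = 0" using div(2) least[of s] unfolding R_def by (meson not_le)
  then have km: "smult k m = r * q1" using div by simp
  have "k \<noteq> 0" using \<open>r \<noteq> 0\<close> by (simp add: k_def)
  have "content m dvd 1" using content_dvd_coeff[of m "degree m"] assms(2) by simp
  then have "content m = 1" by (simp only: is_unit_content_iff)
  then have cq: "content q1 = \<bar>k\<bar>"
    using arg_cong[OF km, of content] cont_r by (simp add: content_mult)
  \<comment> \<open>The content of \<open>q1\<close> is only the absolute value of \<open>k\<close>;
    the factor \<open>sgn k\<close> restores the sign.\<close>
  define q2 where "q2 = smult (sgn k) (primitive_part q1)"
  have "smult k m = smult k (r * q2)"
  proof -
    have "smult k (r * q2) = r * smult (k * sgn k) (primitive_part q1)"
      by (simp add: q2_def)
    also have "k * sgn k = \<bar>k\<bar>" by (rule abs_sgn[symmetric])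
    also have "smult \<bar>k\<bar> (primitive_part q1) = q1"
      by (metis cq content_times_primitive_part)
    finally show ?thesis unfolding km ..
  qed
  then have "smult k (m - r * q2) = 0" by (simp only: smult_diff_right diff_self)
  then have m: "m = r * q2" using \<open>k \<noteq> 0\<close> by simp
  have "\<not> p dvd lead_coeff m" using assms(1,2) not_prime_unit by metis
  then have "degree r = 0 \<or> degree q2 = 0"
    by (rule eisenstein[of p r q2, folded m, OF assms(1) _ dvd assms(4)])
  moreover have "degree r \<noteq> 0"
  proof
    assume "degree r = 0"
    then obtain c where "r = [:c:]" by (rule degree_eq_zeroE)
    then show False using \<open>R r\<close> by (simp add: R_def map_poly_pCons)
  qed
  ultimately have "degree m \<le> degree r" using degree_mult_le[of r q2] m by simp
  then show ?thesis using least[OF r0] deg_r0 by simp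
qed

section \<open>Rank\<close>

lemma power_in_span:
  assumes "algebraic a"
  shows "a ^ n \<in> rat_real.span ((^) a ` {..<degree (min_poly a)})"
proof (induction n rule: less_induct)
  case (less n)
  let ?m = "min_poly a" let ?d = "degree ?m"
  note mp = is_min_poly_min_poly[OF assms]
  show ?case
  proof (cases "n < ?d")
    case True
    then show ?thesis by (intro rat_real.span_base) simp
  next
    case False
    have "degree (map_poly of_rat ?m :: real poly) = ?d"
      by (intro degree_map_poly) simp
    then have "0 = (\<Sum>i\<le>?d. of_rat (coeff ?m i) * a ^ i)"
      using mp by (simp add: is_min_poly_def poly_altdef coeff_map_poly)
    also have "\<dots> = (\<Sum>i<?d. of_rat (coeff ?m i) * a ^ i) + a ^ ?d"
      using mp by (simp add: is_min_poly_def flip: lessThan_Suc_atMost)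
    finally have "a ^ ?d = - (\<Sum>i<?d. of_rat (coeff ?m i) * a ^ i)" by simp
    \<comment> \<open>All exponents \<open>n - ?d + i\<close> on the right are below
      \<open>n\<close>, so the induction hypothesis covers them.\<close>
    then have "a ^ (n - ?d) * a ^ ?d = - (\<Sum>i<?d. of_rat (coeff ?m i) * a ^ (n - ?d + i))"
      by (simp add: sum_distrib_left power_add mult_ac)
    moreover have "\<dots> \<in> rat_real.span ((^) a ` {..<?d})"
      using False
      by (intro rat_real.span_neg rat_real.span_sum rat_real.span_scale less) auto
    ultimately show ?thesis using False by (simp flip: power_add)
  qed
qed

text \<open>The powers below the degree of \<open>min_poly a\<close> are a basis of the rational
  span: they generate by \<open>power_in_span\<close>, and a dependence between them would be a
  polynomial of too small degree vanishing at \<open>a\<close>.\<close>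

lemma monoid_rank_valuation:
  assumes "0 < a" "a \<noteq> 1" "algebraic a"
  shows "monoid_rank (semiring_valuation a) = degree (min_poly a)"
proof -
  let ?S = "semiring_valuation a" and ?d = "degree (min_poly a)"
  let ?B = "(^) a ` {..<?d}"
  note mp = is_min_poly_min_poly[OF assms(3)]
  have inj: "inj_on ((^) a) A" for A
    using inj_power[OF assms(1,2)] by (rule inj_on_subset) simp
  have "?B \<subseteq> gp ?S"
  proof
    fix x assume "x \<in> ?B"
    then have "x \<in> ?S" "0 \<in> ?S" "x = x - 0"
      using add_submonoid_valuation by (auto simp: add_submonoid_def)
    then show "x \<in> gp ?S" unfolding gp_def by blast
  qed
  moreover have "power_sum a N \<in> rat_real.span ?B" for N
    by (induction N)
      (auto intro: rat_real.span_zero rat_real.span_add power_in_span[OF assms(3)])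
  then have "gp ?S \<subseteq> rat_real.span ?B"
    by (auto simp: gp_def elim!: semiring_valuationE intro: rat_real.span_diff)
  moreover have "rat_real.independent ?B"
  proof
    assume "rat_real.dependent ?B"
    then obtain u where u: "\<exists>v\<in>?B. u v \<noteq> 0" "(\<Sum>v\<in>?B. of_rat (u v) * v) = 0"
      by (subst (asm) rat_real.dependent_finite) auto
    define q where "q = (\<Sum>i<?d. monom (u (a ^ i)) i)"
    have coeff_q: "coeff q i = (if i < ?d then u (a ^ i) else 0)" for i
      by (simp add: q_def coeff_sum)
    then have "q \<noteq> 0" using u(1) by (auto simp: poly_eq_iff)
    have "map_poly of_rat q = (\<Sum>i<?d. monom (of_rat (u (a ^ i))) i :: real poly)"
      by (rule poly_eqI) (simp add: coeff_map_poly coeff_q coeff_sum)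
    then have "poly (map_poly of_rat q) a = (\<Sum>i<?d. of_rat (u (a ^ i)) * a ^ i)"
      by (simp add: poly_sum poly_monom)
    also have "\<dots> = 0" using u(2) by (simp add: sum.reindex[OF inj])
    finally have "?d \<le> degree q" using mp \<open>q \<noteq> 0\<close> by (simp add: is_min_poly_def)
    then have "coeff q (degree q) = 0" by (simp add: coeff_q)
    then show False using \<open>q \<noteq> 0\<close> by simp
  qed
  moreover have "card ?B = ?d" by (simp add: card_image[OF inj])
  ultimately show ?thesis unfolding monoid_rank_def by (rule rat_real.dim_unique)
qed

section \<open>Isomorphisms\<close>

text \<open>An isomorphism preserves atoms, so it sends \<open>a\<close> to some
  \<open>b ^ j\<close>, and \<open>b\<close> is the image of some \<open>a ^ k\<close>. Then
  \<open>b ^ (j * k) = b\<close> gives \<open>j = 1\<close>. Hence it maps each sum of powers of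
  \<open>a\<close> to the same sum in \<open>b\<close>.\<close>

lemma isomorphic_imp_same_relations:
  assumes "1 < a" "1 < b" "a \<in> atoms (semiring_valuation a)" "b \<in> atoms (semiring_valuation b)"
    and iso: "semiring_isomorphic (semiring_valuation a) (semiring_valuation b)"
    and eq: "power_sum a P = power_sum a Q"
  shows "power_sum b P = power_sum b Q"
proof -
  let ?A = "semiring_valuation a" and ?B = "semiring_valuation b"
  obtain h where h: "bij_betw h ?A ?B" "h 0 = 0" "h 1 = 1"
    "\<And>x y. x \<in> ?A \<Longrightarrow> y \<in> ?A \<Longrightarrow> h (x + y) = h x + h y"
    "\<And>x y. x \<in> ?A \<Longrightarrow> y \<in> ?A \<Longrightarrow> h (x * y) = h x * h y"
    using iso unfolding semiring_isomorphic_def by blast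
  have inj: "h x = h y \<Longrightarrow> x = y" if "x \<in> ?A" "y \<in> ?A" for x y
    using h(1) that by (meson bij_betw_def inj_onD)
  have img: "h ` ?A = ?B" using h(1) by (simp add: bij_betw_def)
  have gens: "0 \<in> ?A" "1 \<in> ?A" "a \<in> ?A"
    using add_submonoid_valuation[of a] power_in_valuation[of a 0] power_in_valuation[of a 1]
    by (auto simp: add_submonoid_def)
  have h_power: "h (a ^ j) = h a ^ j" for j
    by (induction j) (simp_all add: h(3,5) gens)
  have h_sum: "h (power_sum a N) = power_sum (h a) N" for N
    by (induction N) (simp_all add: h(2,4) h_power)
  have atom_iff: "h x \<in> atoms ?B \<longleftrightarrow> x \<in> atoms ?A" if x: "x \<in> ?A" for x
  proof -
    have "h x \<in> atoms ?B \<longleftrightarrow>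
        h x \<noteq> h 0 \<and> (\<forall>y\<in>?A. \<forall>z\<in>?A. h x = h y + h z \<longrightarrow> h y = h 0 \<or> h z = h 0)"
      using x unfolding atoms_def img[symmetric] by (auto simp: h(2))
    also have "\<dots> \<longleftrightarrow> x \<noteq> 0 \<and> (\<forall>y\<in>?A. \<forall>z\<in>?A. x = y + z \<longrightarrow> y = 0 \<or> z = 0)"
    proof -
      have "h x = h y + h z \<longleftrightarrow> x = y + z" if "y \<in> ?A" "z \<in> ?A" for y z
        using h(4)[OF that] inj[OF x, of "y + z"] add_submonoid_valuation[of a] that
        unfolding add_submonoid_def by metis
      moreover have "h y = h 0 \<longleftrightarrow> y = 0" if "y \<in> ?A" for y
        using inj[OF that gens(1)] by blast
      ultimately show ?thesis using x by meson
    qed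
    finally show ?thesis using x by (simp add: atoms_def)
  qed
  obtain j where j: "h a = b ^ j"
    using atom_iff[OF gens(3)] assms(2,3) atom_is_power[of b "h a"] by auto
  have "b \<in> ?B" using power_in_valuation[of b 1] by simp
  then have "b \<in> h ` ?A" by (simp only: img)
  then obtain x where x: "x \<in> ?A" "h x = b" by (metis imageE)
  then have "x \<in> atoms ?A" using atom_iff[OF x(1)] assms(4) by simp
  then obtain k where "x = a ^ k" using atom_is_power[of a x] assms(1) by auto
  then have "b ^ (j * k) = b ^ 1" using x(2) h_power[of k] j by (simp add: power_mult)
  then have "j * k = 1" using assms(2) by (simp only: power_inject_exp)
  then have "h a = b" using j by simp
  then show ?thesis using eq h_sum by metis
qed

section \<open>The examples\<close>

definition example_poly :: "nat \<Rightarrow> nat \<Rightarrow> int poly" where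
  "example_poly p d = monom 1 d + monom (2 * int p) 1 - (\<Sum>i<d. monom (int p) i)"

lemma coeff_example_poly:
  assumes "d \<ge> 2"
  shows "coeff (example_poly p d) i =
    (if i = d then 1 else if i > d then 0 else if i = 1 then int p else - int p)"
  using assms by (auto simp: example_poly_def coeff_sum)

lemma example_poly_monic:
  assumes "d \<ge> 2"
  shows "degree (example_poly p d) = d" "lead_coeff (example_poly p d) = 1"
proof -
  show deg: "degree (example_poly p d) = d"
    using assms by (intro antisym degree_le le_degree) (auto simp: coeff_example_poly)
  show "lead_coeff (example_poly p d) = 1"
    unfolding deg using assms by (simp add: coeff_example_poly)
qed

lemma poly_example_poly:
  "poly (map_poly of_int (example_poly p d)) (x::real) =
    x ^ d + 2 * real p * x - real p * (\<Sum>i<d. x ^ i)"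
proof -
  have "map_poly of_int (example_poly p d) =
      (monom 1 d + monom (2 * real p) 1 - (\<Sum>i<d. monom (real p) i) :: real poly)"
    by (rule poly_eqI) (auto simp: coeff_map_poly example_poly_def coeff_sum)
  then show ?thesis by (simp add: poly_sum poly_monom sum_distrib_left)
qed

lemma example_root_exists:
  assumes "d \<ge> 3" "p \<ge> 2"
  obtains x :: real where "1 < x" "poly (map_poly of_int (example_poly p d)) x = 0"
proof -
  let ?f = "poly (map_poly of_int (example_poly p d)) :: real \<Rightarrow> real"
  \<comment> \<open>Chosen so that \<open>p * d < b\<close>: the subtracted sum is at most
    \<open>p * d * b ^ (d - 1)\<close>, hence below \<open>b ^ d\<close>.\<close>
  define b where "b = real p * real d + 1"
  \<comment> \<open>The value at 1 is \<open>1 - p * (d - 2)\<close>, at most -1 as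
    \<open>d \<ge> 3\<close> and \<open>p \<ge> 2\<close>.\<close>
  have "real p * (real d - 2) \<ge> 2 * 1" using assms by (intro mult_mono) auto
  then have "?f 1 < 0" by (simp add: poly_example_poly algebra_simps)
  have "b > 1" using assms by (simp add: b_def)
  have "(\<Sum>i<d. b ^ i) \<le> (\<Sum>i<d. b ^ (d - 1))"
    using \<open>b > 1\<close> by (intro sum_mono power_increasing) auto
  then have "real p * (\<Sum>i<d. b ^ i) \<le> real p * (real d * b ^ (d - 1))"
    by (intro mult_left_mono) auto
  also have "\<dots> < b * b ^ (d - 1)"
    using \<open>b > 1\<close> by (simp add: b_def algebra_simps)
  also have "\<dots> = b ^ d" using assms by (simp flip: power_Suc)
  finally have "real p * (\<Sum>i<d. b ^ i) < b ^ d" .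
  moreover have "0 \<le> 2 * real p * b" using \<open>b > 1\<close> by simp
  ultimately have "?f b > 0" unfolding poly_example_poly by linarith
  then show thesis using poly_IVT_pos[OF \<open>b > 1\<close> \<open>?f 1 < 0\<close>] that by blast
qed

text \<open>One fixed root above 1 for each prime, so that the family of examples is an image of the
  set of primes.\<close>

definition example_root :: "nat \<Rightarrow> nat \<Rightarrow> real" where
  "example_root d p = (SOME x. 1 < x \<and> poly (map_poly of_int (example_poly p d)) x = 0)"

context
  fixes d p :: nat and b :: real
  assumes d: "d \<ge> 3" and p: "prime p" and b_def: "b = example_root d p"
begin

lemma example_root: "1 < b" "poly (map_poly of_int (example_poly p d)) b = 0"
proof -
  have "p \<ge> 2" using p by (rule prime_ge_2_nat)
  then have "\<exists>x::real. 1 < x \<and> poly (map_poly of_int (example_poly p d)) x = 0"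
    using example_root_exists[OF d] by blast
  then have "1 < b \<and> poly (map_poly of_int (example_poly p d)) b = 0"
    unfolding b_def example_root_def by (rule someI_ex)
  then show "1 < b" "poly (map_poly of_int (example_poly p d)) b = 0" by auto
qed

lemma example_root_eq: "b ^ d + 2 * real p * b = real p * (\<Sum>i<d. b ^ i)"
  using example_root(2) by (simp add: poly_example_poly)

lemma is_min_poly_example: "is_min_poly b (map_poly of_int (example_poly p d))"
proof -
  let ?m = "example_poly p d"
  have "d \<ge> 2" using d by simp
  note monic = example_poly_monic[OF this, of p] and coeff = coeff_example_poly[OF this, of p]
  have deg: "degree (map_poly of_int ?m :: rat poly) = d"
    using monic by (subst degree_map_poly) auto
  have "degree ?m \<le> degree q" if "q \<noteq> 0" "poly (map_poly of_rat q) b = 0" for q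
  proof (rule eisenstein_min_degree[of "int p" _ b])
    show "prime (int p)" using p by simp
    show "int p dvd coeff ?m i" if "i < degree ?m" for i
      using that monic by (simp add: coeff)
    have "p < p\<^sup>2" using prime_gt_1_nat[OF p] by (simp add: power2_eq_square)
    then have "\<not> p\<^sup>2 dvd p" using prime_gt_0_nat[OF p] nat_dvd_not_less by blast
    then show "\<not> (int p)\<^sup>2 dvd coeff ?m 0"
      using d by (simp add: coeff flip: of_nat_power)
  qed (use monic that example_root in auto)
  moreover have "map_poly of_rat (map_poly of_int ?m) = (map_poly of_int ?m :: real poly)"
    by (rule poly_eqI) (simp add: coeff_map_poly)
  ultimately show ?thesis
    using deg monic example_root(2) by (simp add: is_min_poly_def coeff_map_poly)
qed

lemma algebraic_example: "algebraic b"
  using is_min_poly_example unfolding is_min_poly_def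
  by (metis algebraic_of_rat_root leading_coeff_0_iff zero_neq_one)

lemma min_poly_example: "min_poly b = map_poly of_int (example_poly p d)"
  by (rule min_poly_eqI[OF is_min_poly_example algebraic_example])

lemma degree_min_poly_example: "degree (min_poly b) = d"
proof -
  have "d \<ge> 2" using d by simp
  then show ?thesis
    unfolding min_poly_example using example_poly_monic[of d p] by (subst degree_map_poly) auto
qed

text \<open>Since \<open>b > 1\<close>, a decomposition of \<open>b ^ d\<close> into nonzero
  summands uses only exponents below \<open>d\<close>. Subtracting it from \<open>X ^ d\<close>
  gives a monic polynomial of degree \<open>d\<close> vanishing at \<open>b\<close>, hence the
  minimal polynomial; but its linear coefficient is at most 0, while that of
  \<open>example_poly p d\<close> is \<open>p\<close>.\<close>

lemma example_top_power_atom: "b ^ d \<in> atoms (semiring_valuation b)"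
proof -
  note b = example_root(1)
  have "x = 0 \<or> y = 0"
    if x: "x \<in> semiring_valuation b" and y: "y \<in> semiring_valuation b" and xy: "b ^ d = x + y" for x y
  proof (rule ccontr)
    assume "\<not> (x = 0 \<or> y = 0)"
    obtain M where M: "x = power_sum b M" using x by (rule semiring_valuationE)
    obtain N where N: "y = power_sum b N" using y by (rule semiring_valuationE)
    have "0 < x" "0 < y"
      using \<open>\<not> (x = 0 \<or> y = 0)\<close> valuation_ge_1[OF _ x] valuation_ge_1[OF _ y] b by auto
    then have "b ^ i < b ^ d" if "i \<in># M + N" for i
    proof -
      have "b ^ i \<le> x \<or> b ^ i \<le> y"
        using that power_sum_ge_member[of b i] b unfolding M N by auto
      then show ?thesis using \<open>0 < x\<close> \<open>0 < y\<close> xy by linarith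
    qed
    then have less: "i < d" if "i \<in># M + N" for i
      using that b power_less_imp_less_exp by blast
    define q :: "rat poly" where "q = monom 1 d - multiset_poly (M + N)"
    have zero: "count (M + N) i = 0" if "i \<ge> d" for i
      using less[of i] that by (meson count_inI not_le)
    have coeff: "coeff q i = (if i = d then 1 else - of_nat (count (M + N) i))" for i
      using zero[of d] by (simp add: q_def)
    have "degree q = d"
      using zero by (intro antisym degree_le le_degree) (auto simp: coeff)
    moreover have "map_poly of_rat q = (monom 1 d - multiset_poly (M + N) :: real poly)"
      by (rule poly_eqI) (simp add: q_def coeff_map_poly of_rat_diff of_rat_add)
    then have "poly (map_poly of_rat q) b = 0" using M N xy by (simp add: poly_monom)
    ultimately have "is_min_poly b q"
      using is_min_poly_min_poly[OF algebraic_example] degree_min_poly_example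
      by (simp add: is_min_poly_def coeff)
    then have "q = map_poly of_int (example_poly p d)"
      using min_poly_eqI[OF _ algebraic_example] min_poly_example by metis
    then have "coeff q 1 = of_nat p" using d by (simp add: coeff_map_poly coeff_example_poly)
    moreover have "coeff q 1 \<le> 0" using d by (simp add: coeff)
    ultimately show False using prime_gt_0_nat[OF p] by simp
  qed
  then show ?thesis using b by (simp add: atoms_def)
qed

text \<open>This is \<open>(X + 1) m(X) = 0\<close> at \<open>b\<close>, where \<open>m\<close> is
  \<open>example_poly p d\<close>. The factor \<open>X + 1\<close> adds neighbouring coefficients,
  so the positive linear one cancels against both its neighbours and only nonnegative terms remain
  on the right.\<close>

lemma example_next_power:
  "b ^ Suc d = (real p - 1) * b ^ d + (real p + 2 * real p * (\<Sum>i=3..<d. b ^ i))"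
proof -
  have split: "(\<Sum>i<d. b ^ i) = 1 + b + b\<^sup>2 + (\<Sum>i=3..<d. b ^ i)"
  proof -
    have "(\<Sum>i<d. b ^ i) = (\<Sum>i<3. b ^ i) + (\<Sum>i=3..<d. b ^ i)"
      using d by (simp add: lessThan_atLeast0 sum.atLeastLessThan_concat)
    then show ?thesis by (simp add: eval_nat_numeral)
  qed
  have "b * (\<Sum>i<d. b ^ i) + 1 = (\<Sum>i<d. b ^ i) + b ^ d"
    using sum.lessThan_Suc_shift[of "\<lambda>i. b ^ i" d] by (simp add: sum_distrib_left)
  then have shift: "b * (\<Sum>i<d. b ^ i) = (\<Sum>i<d. b ^ i) + b ^ d - 1" by simp
  have "b ^ d = real p * (\<Sum>i<d. b ^ i) - 2 * real p * b"
    using example_root_eq by simp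
  then have "b ^ Suc d = b * (real p * (\<Sum>i<d. b ^ i) - 2 * real p * b)" by simp
  also have "\<dots> = real p * ((\<Sum>i<d. b ^ i) + b ^ d - 1) - 2 * real p * b\<^sup>2"
    unfolding shift[symmetric] by (simp add: algebra_simps power2_eq_square)
  \<comment> \<open>One copy of \<open>b ^ d\<close> is split off together with
    \<open>2 * p * b\<close>, to be replaced by the full sum through
    \<open>example_root_eq\<close>.\<close>
  also have "\<dots> = (real p - 1) * b ^ d + (b ^ d + 2 * real p * b)
      + real p * ((\<Sum>i<d. b ^ i) - 1 - 2 * b - 2 * b\<^sup>2)"
    by (simp add: algebra_simps)
  also have "\<dots> = (real p - 1) * b ^ d + real p * (2 * (\<Sum>i<d. b ^ i) - 1 - 2 * b - 2 * b\<^sup>2)"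
    unfolding example_root_eq by (simp add: algebra_simps)
  finally show ?thesis unfolding split by (simp add: algebra_simps)
qed

lemma atoms_example: "atoms (semiring_valuation b) = {b ^ j | j. 0 \<le> j \<and> j \<le> d}"
proof -
  note b = example_root(1)
  have "b ^ Suc d \<notin> atoms (semiring_valuation b)"
  proof
    assume atom: "b ^ Suc d \<in> atoms (semiring_valuation b)"
    \<comment> \<open>The two parts of the right side of \<open>example_next_power\<close>.
      \<open>x\<close> is nonzero because \<open>p > 1\<close>, and \<open>y\<close> because of its
      constant term \<open>p\<close>.\<close>
    define x where "x = power_sum b (replicate_mset (p - 1) d)"
    define y where "y = power_sum b (replicate_mset p 0 + (\<Sum>i=3..<d. replicate_mset (2 * p) i))"
    have x: "x = (real p - 1) * b ^ d"
      using prime_gt_0_nat[OF p] by (simp add: x_def of_nat_diff)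
    have y: "y = real p + 2 * real p * (\<Sum>i=3..<d. b ^ i)"
      by (simp add: y_def power_sum_Sum sum_distrib_left)
    have "0 \<le> 2 * real p * (\<Sum>i=3..<d. b ^ i)" using b by (simp add: sum_nonneg)
    then have "y \<noteq> 0" using y prime_gt_0_nat[OF p] by auto
    moreover have "x \<noteq> 0" using x prime_gt_1_nat[OF p] b by simp
    moreover have "b ^ Suc d = x + y" unfolding x y by (rule example_next_power)
    moreover have "x \<in> semiring_valuation b" "y \<in> semiring_valuation b"
      by (simp_all only: x_def y_def power_sum_in_valuation)
    ultimately show False using atom unfolding atoms_def by blast
  qed
  then have "b ^ j \<in> atoms (semiring_valuation b) \<longleftrightarrow> j \<le> d" for j
    using atom_power_down[of b d j] atom_power_down[of b j "Suc d"] example_top_power_atom b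
    by (auto simp flip: not_less_eq_eq)
  moreover have "0 < b" using b by simp
  ultimately have "atoms (semiring_valuation b) = {b ^ j | j. j \<le> d}"
    using atom_is_power[of b] by blast
  then show ?thesis by simp
qed

lemma example_root_atom: "b \<in> atoms (semiring_valuation b)"
  using atom_power_down[OF _ example_top_power_atom, of 1] example_root(1) d by simp

lemma proper_OHFM_example: "proper_OHFM (semiring_valuation b)"
  using example_root(1) algebraic_example atoms_example degree_min_poly_example
  by (intro proper_OHFM_if) auto

lemma monoid_rank_example: "monoid_rank (semiring_valuation b) = d"
  using example_root(1) algebraic_example degree_min_poly_example
  by (simp add: monoid_rank_valuation)

end

section \<open>Non-isomorphic examples and the final statement\<close>

lemma example_isomorphic_imp_eq:
  assumes "d \<ge> 3" "prime p" "prime q"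
    and iso: "semiring_isomorphic (semiring_valuation (example_root d p))
      (semiring_valuation (example_root d q))"
  shows "p = q"
proof -
  let ?a = "example_root d p" and ?b = "example_root d q"
  let ?P = "replicate_mset 1 d + replicate_mset (2 * p) 1"
  let ?Q = "\<Sum>i<d. replicate_mset p i"
  note a = example_root[OF assms(1,2) refl] and b = example_root[OF assms(1,3) refl]
  have sums: "power_sum x ?P = x ^ d + 2 * real p * x"
    "power_sum x ?Q = real p * (\<Sum>i<d. x ^ i)" for x :: real
    by (simp_all add: power_sum_Sum sum_distrib_left)
  have "power_sum ?a ?P = power_sum ?a ?Q"
    unfolding sums by (rule example_root_eq[OF assms(1,2) refl])
  then have "power_sum ?b ?P = power_sum ?b ?Q"
    by (rule isomorphic_imp_same_relations[OF a(1) b(1) example_root_atom[OF assms(1,2) refl]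
          example_root_atom[OF assms(1,3) refl] iso])
  \<comment> \<open>The transported relation and the defining one write \<open>?b ^ d\<close> as
    \<open>p\<close> times and as \<open>q\<close> times the same number, which is nonzero because
    \<open>?b ^ d\<close> is.\<close>
  then have p_eq: "?b ^ d = real p * ((\<Sum>i<d. ?b ^ i) - 2 * ?b)"
    unfolding sums by (simp add: algebra_simps)
  moreover have q_eq: "?b ^ d = real q * ((\<Sum>i<d. ?b ^ i) - 2 * ?b)"
    using example_root_eq[OF assms(1,3) refl] by (simp add: algebra_simps)
  moreover have "?b ^ d \<noteq> 0" using b(1) by simp
  ultimately show ?thesis by (metis mult_cancel_right mult_zero_right of_nat_eq_iff)
qed

lemma semiring_isomorphic_refl: "semiring_isomorphic S S"
  unfolding semiring_isomorphic_def by (rule exI[of _ id]) simp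

text \<open>The conjunct \<open>\<alpha> \<noteq> 1\<close> excludes a degenerate case: for
  \<open>\<alpha> = 1\<close> the monoid is that of the natural numbers, a UFM, yet its only atom 1
  equals both \<open>1 ^ 0\<close> and \<open>1 ^ 1\<close>, so the description of the atoms still
  holds.\<close>

theorem theorem5p10:
  fixes \<alpha> :: real
  assumes "\<alpha> > 0"
  shows "(proper_OHFM (semiring_valuation \<alpha>) \<longleftrightarrow>
           \<alpha> \<noteq> 1 \<and> algebraic \<alpha> \<and>
           atoms (semiring_valuation \<alpha>) = {\<alpha> ^ j | j. 0 \<le> j \<and> j \<le> degree (min_poly \<alpha>)})
       \<and> (\<forall>d::nat. d \<ge> 3 \<longrightarrow>
           (\<exists>B :: real set. infinite B \<and>
              (\<forall>\<beta>\<in>B. \<beta> > 0 \<and> algebraic \<beta> \<and> proper_OHFM (semiring_valuation \<beta>) \<and>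
                 monoid_rank (semiring_valuation \<beta>) = d) \<and>
              (\<forall>\<beta>\<in>B. \<forall>\<gamma>\<in>B. \<beta> \<noteq> \<gamma> \<longrightarrow>
                 \<not> semiring_isomorphic (semiring_valuation \<beta>) (semiring_valuation \<gamma>))))"
proof (intro conjI allI impI)
  show "proper_OHFM (semiring_valuation \<alpha>) \<longleftrightarrow> \<alpha> \<noteq> 1 \<and> algebraic \<alpha> \<and>
      atoms (semiring_valuation \<alpha>) = {\<alpha> ^ j | j. 0 \<le> j \<and> j \<le> degree (min_poly \<alpha>)}"
    using proper_OHFM_imp[OF assms] proper_OHFM_if[OF assms] by blast
next
  fix d :: nat
  assume d: "d \<ge> 3"
  let ?B = "example_root d ` {p. prime p}"
  \<comment> \<open>Equal roots have equal, hence isomorphic, valuations, so the primes agree;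
    infinitely many primes thus give infinitely many roots.\<close>
  have "inj_on (example_root d) {p. prime p}"
    using example_isomorphic_imp_eq[OF d] semiring_isomorphic_refl
    by (metis inj_onI mem_Collect_eq)
  then have "infinite ?B" using primes_infinite by (simp add: finite_image_iff)
  moreover have "\<beta> > 0 \<and> algebraic \<beta> \<and> proper_OHFM (semiring_valuation \<beta>) \<and>
      monoid_rank (semiring_valuation \<beta>) = d" if "\<beta> \<in> ?B" for \<beta>
  proof -
    obtain p where p: "prime p" "\<beta> = example_root d p" using \<open>\<beta> \<in> ?B\<close> by blast
    show ?thesis
      using example_root(1)[OF d p] algebraic_example[OF d p] proper_OHFM_example[OF d p]
        monoid_rank_example[OF d p] by simp
  qed
  moreover have "\<beta> = \<gamma>"
    if "\<beta> \<in> ?B" "\<gamma> \<in> ?B" "semiring_isomorphic (semiring_valuation \<beta>) (semiring_valuation \<gamma>)" for \<beta> \<gamma>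
    using that example_isomorphic_imp_eq[OF d] by blast
  ultimately show "\<exists>B :: real set. infinite B \<and>
      (\<forall>\<beta>\<in>B. \<beta> > 0 \<and> algebraic \<beta> \<and> proper_OHFM (semiring_valuation \<beta>) \<and>
         monoid_rank (semiring_valuation \<beta>) = d) \<and>
      (\<forall>\<beta>\<in>B. \<forall>\<gamma>\<in>B. \<beta> \<noteq> \<gamma> \<longrightarrow>
         \<not> semiring_isomorphic (semiring_valuation \<beta>) (semiring_valuation \<gamma>))"
    by (intro exI[of _ ?B]) blast
qed

end
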